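(* Let $a,d,f,g\in\mathbb{C}$ with $a\notin\{-1,0,2,\tfrac12\}$, and suppose that at least one of the following conditions holds: (1) $d=1+2a$, $g=-1\pm ia\sqrt3$ (either sign), $f\neq 0$; (2) $d=1+2a$, $g=3a-1$, $f=1+a$; (3) ($d=1-a+ia\sqrt3$, $g=-1-ia\sqrt3$, $f\neq0$) or ($d=1-a-ia\sqrt3$, $g=-1+ia\sqrt3$, $f\neq 0$); (4) ($d=1-a+ia\sqrt3$, $g=-1+ia\sqrt3$, $f=1+a$) or ($d=1-a-ia\sqrt3$, $g=-1-ia\sqrt3$, $f=1+a$); (5) $d=1-a\pm ia\sqrt3$ (either sign), $g=3a-1$, $f=1+a$. Let $$A=\begin{pmatrix}a&a-2&a-2\\ -2a+1&d&-2a+1\\ f&f&g\end{pmatrix},\quad B=\begin{pmatrix}a-2&-a+2&-a+2\\ 2a-1&-2a+1&2a-1\\ -f&-f&f\end{pmatrix},\quad D=\begin{pmatrix}-a+3&3a-3&-a-1\\ -a+2&3a-2&-3a\\ 3&2a-1&-2a-1\end{pmatrix}$$ (so that $B$ is invertible, since $f\ne0$ in every case), and let $C=B^{-1}A^2-B^{-1}ABDB^{-1}+D^2B^{-1}$, the unique $3\times3$ matrix satisfying $A^2B-BCB-ABD+BD^2=0$. Then $$\rho(\sigma_1)=\begin{pmatrix}A&B\\ C&D\end{pmatrix},\qquad \rho(\sigma_2)=\begin{pmatrix}A&-B\\ -C&D\end{pmatrix}$$ defines a representation $\rho:B_3\to GL(6,\mathbb{C})$.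
   Context: $B_3=\langle \sigma_1,\sigma_2 \mid \sigma_1\sigma_2\sigma_1=\sigma_2\sigma_1\sigma_2\rangle$ is the braid group on three strings; $i=\sqrt{-1}$. Saying that matrices $\rho(\sigma_1),\rho(\sigma_2)$ define a representation means that they are invertible and the assignment extends to a group homomorphism $B_3\to GL(6,\mathbb{C})$. *)

theory Defs
  imports Complex_Main "HOL-Algebra.Coset" "Jordan_Normal_Form.Matrix"
begin

section \<open>Groups given by generators and relations\<close>

datatype 'g letter = Pos 'g | Neg 'g

type_synonym 'g group_word = "'g letter list"

fun inv_letter :: "'g letter \<Rightarrow> 'g letter" where
  "inv_letter (Pos x) = Neg x"
| "inv_letter (Neg x) = Pos x"

text \<open>The least congruence on words that makes @ descend to a group operation and identifies
  the two sides of every pair in \<open>R\<close>.\<close>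

inductive pres_eq :: "('g group_word \<times> 'g group_word) set \<Rightarrow> 'g group_word \<Rightarrow> 'g group_word \<Rightarrow> bool"
  for R where
  refl: "pres_eq R u u"
| sym: "pres_eq R u v \<Longrightarrow> pres_eq R v u"
| trans: "pres_eq R u v \<Longrightarrow> pres_eq R v w \<Longrightarrow> pres_eq R u w"
| append: "pres_eq R u u' \<Longrightarrow> pres_eq R v v' \<Longrightarrow> pres_eq R (u @ v) (u' @ v')"
| cancel: "pres_eq R [l, inv_letter l] []"
| rel: "(u, v) \<in> R \<Longrightarrow> pres_eq R u v"

definition pres_class :: "('g group_word \<times> 'g group_word) set \<Rightarrow> 'g group_word \<Rightarrow> 'g group_word set" where
  "pres_class R w = {w'. pres_eq R w w'}"

definition presented_group ::
    "('g group_word \<times> 'g group_word) set \<Rightarrow> 'g group_word set monoid" where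
  "presented_group R =
     \<lparr>carrier = range (pres_class R),
      monoid.mult = (\<lambda>X Y. \<Union>u\<in>X. \<Union>v\<in>Y. pres_class R (u @ v)),
      one = pres_class R []\<rparr>"

lemma pres_class_eq_iff: "pres_class R u = pres_class R v \<longleftrightarrow> pres_eq R u v"
  unfolding pres_class_def set_eq_iff mem_Collect_eq
  by (meson pres_eq.refl pres_eq.sym pres_eq.trans)

lemma pres_class_mult:
  "pres_class R u \<otimes>\<^bsub>presented_group R\<^esub> pres_class R v = pres_class R (u @ v)"
proof -
  have "pres_class R (u' @ v') = pres_class R (u @ v)"
    if "u' \<in> pres_class R u" "v' \<in> pres_class R v" for u' v'
    using that unfolding pres_class_eq_iff
    by (simp add: pres_class_def pres_eq.append pres_eq.sym)
  moreover have "u \<in> pres_class R u" "v \<in> pres_class R v"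
    by (auto simp: pres_class_def intro: pres_eq.refl)
  ultimately have "(\<Union>u'\<in>pres_class R u. \<Union>v'\<in>pres_class R v. pres_class R (u' @ v')) =
      pres_class R (u @ v)"
    by blast
  then show ?thesis by (simp add: presented_group_def)
qed

lemma pres_eq_inverse: "pres_eq R (rev (map inv_letter w) @ w) []"
proof (induction w)
  case Nil
  show ?case by (simp add: pres_eq.refl)
next
  case (Cons l w)
  have "inv_letter (inv_letter l) = l" by (cases l) auto
  then have "pres_eq R [inv_letter l, l] []"
    by (metis pres_eq.cancel)
  then have "pres_eq R ((rev (map inv_letter w) @ [inv_letter l, l]) @ w)
      ((rev (map inv_letter w) @ []) @ w)"
    by (intro pres_eq.append pres_eq.refl)
  with Cons.IH show ?case
    by (simp add: pres_eq.trans[of R _ "rev (map inv_letter w) @ w"])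
qed

lemma group_presented_group: "group (presented_group R)"
proof (rule groupI)
  note [simp] = pres_class_mult
  have carrier: "carrier (presented_group R) = range (pres_class R)"
    and one: "\<one>\<^bsub>presented_group R\<^esub> = pres_class R []"
    by (simp_all add: presented_group_def)
  show "x \<otimes>\<^bsub>presented_group R\<^esub> y \<in> carrier (presented_group R)"
    if "x \<in> carrier (presented_group R)" "y \<in> carrier (presented_group R)" for x y
    using that by (auto simp: carrier)
  show "\<one>\<^bsub>presented_group R\<^esub> \<in> carrier (presented_group R)"
    by (simp add: carrier one)
  show "x \<otimes>\<^bsub>presented_group R\<^esub> y \<otimes>\<^bsub>presented_group R\<^esub> z =
      x \<otimes>\<^bsub>presented_group R\<^esub> (y \<otimes>\<^bsub>presented_group R\<^esub> z)"
    if "x \<in> carrier (presented_group R)" "y \<in> carrier (presented_group R)"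
      "z \<in> carrier (presented_group R)" for x y z
    using that by (auto simp: carrier)
  show "\<one>\<^bsub>presented_group R\<^esub> \<otimes>\<^bsub>presented_group R\<^esub> x = x"
    if "x \<in> carrier (presented_group R)" for x
    using that by (auto simp: carrier one)
  show "\<exists>y\<in>carrier (presented_group R). y \<otimes>\<^bsub>presented_group R\<^esub> x = \<one>\<^bsub>presented_group R\<^esub>"
    if x: "x \<in> carrier (presented_group R)" for x
  proof -
    obtain w where "x = pres_class R w" using x by (auto simp: carrier)
    then have "pres_class R (rev (map inv_letter w)) \<otimes>\<^bsub>presented_group R\<^esub> x = \<one>\<^bsub>presented_group R\<^esub>"
      by (simp add: one pres_class_eq_iff pres_eq_inverse)
    then show ?thesis by (auto simp: carrier)
  qed
qed

section \<open>The braid group on three strings and its representations\<close>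

datatype braid_gen = S1 | S2

definition braid3_relations :: "(braid_gen group_word \<times> braid_gen group_word) set" where
  "braid3_relations = {([Pos S1, Pos S2, Pos S1], [Pos S2, Pos S1, Pos S2])}"

definition B3 :: "braid_gen group_word set monoid" where
  "B3 = presented_group braid3_relations"

definition \<sigma>1 :: "braid_gen group_word set" where
  "\<sigma>1 = pres_class braid3_relations [Pos S1]"

definition \<sigma>2 :: "braid_gen group_word set" where
  "\<sigma>2 = pres_class braid3_relations [Pos S2]"

definition GL :: "nat \<Rightarrow> complex mat monoid" where
  "GL n = units_of (ring_mat TYPE(complex) n ())"

definition defines_B3_representation :: "nat \<Rightarrow> complex mat \<Rightarrow> complex mat \<Rightarrow> bool" where
  "defines_B3_representation n X Y \<longleftrightarrow>
     X \<in> carrier (GL n) \<and> Y \<in> carrier (GL n) \<and>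
     (\<exists>\<rho> \<in> hom B3 (GL n). \<rho> \<sigma>1 = X \<and> \<rho> \<sigma>2 = Y)"

end

theory Submission
  imports Defs "Jordan_Normal_Form.Determinant"
begin

text \<open>
  Put \<open>E = B D B\<^sup>-\<^sup>1\<close> and \<open>K = A - E\<close>. Then \<open>B C = A\<^sup>2 - A E + E\<^sup>2 = K\<^sup>2 + E K + E\<^sup>2\<close>, so conjugation by
  \<open>diag(1, B)\<close> turns the two block matrices into \<open>[E + K, \<plusminus>1; \<plusminus>P, E]\<close> with \<open>P = K\<^sup>2 + E K + E\<^sup>2\<close>.
  For these the only entry of the braid relation that is not an identity in the free algebra on
  \<open>E\<close> and \<open>K\<close> is \<open>K\<^sup>3 E = E K\<^sup>3\<close>, and they are invertible whenever \<open>K\<close> is, because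
  \<open>P - E (E + K) = K\<^sup>2\<close>. In each of the five cases \<open>K\<close> is upper triangular and \<open>K\<^sup>3 = 8 a\<^sup>3\<close>.
\<close>

section \<open>Evaluation of words and the universal property of a presentation\<close>

definition word_eval :: "('a, 'b) monoid_scheme \<Rightarrow> ('g \<Rightarrow> 'a) \<Rightarrow> 'g group_word \<Rightarrow> 'a" where
  "word_eval G h w =
     foldr (\<lambda>l x. (case l of Pos s \<Rightarrow> h s | Neg s \<Rightarrow> inv\<^bsub>G\<^esub> (h s)) \<otimes>\<^bsub>G\<^esub> x) w \<one>\<^bsub>G\<^esub>"

context group
begin

lemma word_eval_simps [simp]:
  "word_eval G h [] = \<one>"
  "word_eval G h (Pos s # w) = h s \<otimes> word_eval G h w"
  "word_eval G h (Neg s # w) = inv (h s) \<otimes> word_eval G h w"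
  by (simp_all add: word_eval_def)

lemma word_eval_closed [simp]:
  assumes "\<And>s. h s \<in> carrier G"
  shows "word_eval G h w \<in> carrier G"
proof (induction w)
  case (Cons l w)
  then show ?case using assms by (cases l) auto
qed simp

lemma word_eval_append:
  assumes "\<And>s. h s \<in> carrier G"
  shows "word_eval G h (u @ v) = word_eval G h u \<otimes> word_eval G h v"
proof (induction u)
  case (Cons l u)
  then show ?case using assms by (cases l) (auto simp: m_assoc)
qed (use assms in simp)

text \<open>Every rule generating the congruence except \<open>rel\<close> is respected by
  evaluation in any group, and \<open>rel\<close> is covered by the hypothesis on \<open>R\<close>.
  Hence evaluation is well defined on classes.\<close>

lemma word_eval_pres_eq:
  assumes h: "\<And>s. h s \<in> carrier G"
    and R: "\<And>u v. (u, v) \<in> R \<Longrightarrow> word_eval G h u = word_eval G h v"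
    and "pres_eq R u v"
  shows "word_eval G h u = word_eval G h v"
  using assms(3)
proof induction
  case (cancel l)
  then show ?case using h by (cases l) auto
qed (auto simp: word_eval_append h R)

text \<open>Von Dyck's theorem. The homomorphism evaluates an arbitrarily chosen representative of a
  class; by \<open>word_eval_pres_eq\<close> the choice is immaterial.\<close>

theorem presented_group_universal:
  assumes h: "\<And>s. h s \<in> carrier G"
    and R: "\<And>u v. (u, v) \<in> R \<Longrightarrow> word_eval G h u = word_eval G h v"
  obtains \<phi> where "\<phi> \<in> hom (presented_group R) G" "\<And>w. \<phi> (pres_class R w) = word_eval G h w"
proof
  define \<phi> where "\<phi> = (\<lambda>X. word_eval G h (SOME w. w \<in> X))"
  show \<phi>: "\<phi> (pres_class R w) = word_eval G h w" for w
  proof -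
    have "w \<in> pres_class R w"
      by (simp add: pres_class_def pres_eq.refl)
    then have "(SOME w'. w' \<in> pres_class R w) \<in> pres_class R w"
      by (rule someI)
    then have "pres_eq R w (SOME w'. w' \<in> pres_class R w)"
      by (simp add: pres_class_def)
    from word_eval_pres_eq[OF h R this] show ?thesis
      by (simp add: \<phi>_def)
  qed
  have "carrier (presented_group R) = range (pres_class R)"
    by (simp add: presented_group_def)
  then show "\<phi> \<in> hom (presented_group R) G"
    by (auto simp: hom_def \<phi> h pres_class_mult word_eval_append)
qed

end

section \<open>Invertible matrices and representations of \<open>B3\<close>\<close>

lemma GL_simps [simp]:
  "monoid.mult (GL n) = (*)"
  "one (GL n) = 1\<^sub>m n"
  by (simp_all add: GL_def units_of_mult units_of_one ring_mat_simps)

lemma GL_carrier_iff: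
  "X \<in> carrier (GL n) \<longleftrightarrow>
     X \<in> carrier_mat n n \<and> (\<exists>Y \<in> carrier_mat n n. Y * X = 1\<^sub>m n \<and> X * Y = 1\<^sub>m n)"
  by (simp add: GL_def units_of_carrier Units_def ring_mat_simps)

lemma GL_carrierI:
  assumes "X \<in> carrier_mat n n" "Y \<in> carrier_mat n n" "X * Y = 1\<^sub>m n" "Y * X = 1\<^sub>m n"
  shows "X \<in> carrier (GL n)"
  using assms by (auto simp: GL_carrier_iff)

lemma group_GL: "group (GL n)"
proof -
  interpret ring "ring_mat TYPE(complex) n ()" by (rule ring_mat)
  show ?thesis unfolding GL_def by (rule units_group)
qed

lemma GL_inv_eq:
  assumes "X \<in> carrier_mat n n" "Y \<in> carrier_mat n n" "X * Y = 1\<^sub>m n" "Y * X = 1\<^sub>m n"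
  shows "inv\<^bsub>GL n\<^esub> X = Y"
  using assms by (intro group.inv_equality[OF group_GL]) (auto simp: GL_carrier_iff)

text \<open>The universal property for the single braid relation. Products are nested to the right
  because \<open>word_eval\<close> folds words that way.\<close>

lemma defines_B3_representationI:
  assumes X: "X \<in> carrier (GL n)" and Y: "Y \<in> carrier (GL n)"
    and braid: "X * (Y * X) = Y * (X * Y)"
  shows "defines_B3_representation n X Y"
proof -
  interpret group "GL n" by (rule group_GL)
  define h where "h = (\<lambda>s. case s of S1 \<Rightarrow> X | S2 \<Rightarrow> Y)"
  have h: "h s \<in> carrier (GL n)" for s
    using X Y by (cases s) (auto simp: h_def)
  have "X \<in> carrier_mat n n" "Y \<in> carrier_mat n n"
    using X Y by (auto simp: GL_carrier_iff)
  then have R: "word_eval (GL n) h u = word_eval (GL n) h v" if "(u, v) \<in> braid3_relations" for u v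
    using that braid by (simp add: braid3_relations_def h_def)
  obtain \<phi> where "\<phi> \<in> hom B3 (GL n)" "\<And>w. \<phi> (pres_class braid3_relations w) = word_eval (GL n) h w"
    using presented_group_universal[of h braid3_relations, OF h R] unfolding B3_def by auto
  moreover from this have "\<phi> \<sigma>1 = X" "\<phi> \<sigma>2 = Y"
    using \<open>X \<in> carrier_mat n n\<close> \<open>Y \<in> carrier_mat n n\<close>
    by (simp_all add: \<sigma>1_def \<sigma>2_def h_def)
  ultimately show ?thesis
    using X Y unfolding defines_B3_representation_def by blast
qed

text \<open>Conjugation is an automorphism of \<open>GL n\<close>, so its composite with a
  homomorphism is again one. This permits passing to a normal form with \<open>1\<close> or
  \<open>-1\<close> in the upper right block.\<close>

lemma defines_B3_representation_conj:
  assumes XY: "defines_B3_representation n X Y"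
    and T: "T \<in> carrier_mat n n" "Ti \<in> carrier_mat n n" "T * Ti = 1\<^sub>m n" "Ti * T = 1\<^sub>m n"
  shows "defines_B3_representation n (Ti * (X * T)) (Ti * (Y * T))"
proof -
  interpret group "GL n" by (rule group_GL)
  have TGL: "T \<in> carrier (GL n)" "Ti \<in> carrier (GL n)"
    using T by (auto simp: GL_carrier_iff)
  obtain \<rho> where \<rho>: "\<rho> \<in> hom B3 (GL n)" "\<rho> \<sigma>1 = X" "\<rho> \<sigma>2 = Y"
    and X: "X \<in> carrier (GL n)" and Y: "Y \<in> carrier (GL n)"
    using XY by (auto simp: defines_B3_representation_def)
  have closed: "Ti * (Z * T) \<in> carrier (GL n)" if "Z \<in> carrier (GL n)" for Z
    using TGL that m_closed by simp
  have "Ti * (U * V * T) = Ti * (U * T) * (Ti * (V * T))"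
    if "U \<in> carrier (GL n)" "V \<in> carrier (GL n)" for U V
  proof -
    have "T * (Ti * (V * T)) = V * T"
      using that T TGL m_assoc[of T Ti "V * T"] m_closed[of V T] l_one[of "V * T"] by simp
    then show ?thesis
      using that TGL m_assoc m_closed by simp
  qed
  then have "(\<lambda>x. Ti * (\<rho> x * T)) \<in> hom B3 (GL n)"
    using \<rho>(1) closed by (auto simp: hom_def Pi_iff)
  then show ?thesis
    unfolding defines_B3_representation_def using closed X Y \<rho> by auto
qed

section \<open>Block matrices satisfying the braid relation\<close>

lemma braid_of_cube_scalar:
  fixes E K :: "complex mat"
  assumes E: "E \<in> carrier_mat n n" and K: "K \<in> carrier_mat n n"
    and cube: "K * (K * K) = \<kappa> \<cdot>\<^sub>m 1\<^sub>m n" and \<kappa>: "\<kappa> \<noteq> 0"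
  defines "P \<equiv> K * K + E * K + E * E"
  shows "defines_B3_representation (n + n)
    (four_block_mat (E + K) (1\<^sub>m n) P E) (four_block_mat (E + K) (- 1\<^sub>m n) (- P) E)"
    (is "defines_B3_representation _ ?X ?Y")
proof -
  note [simp] = E K carrier_matD[OF E] carrier_matD[OF K]
    add_mult_distrib_mat[where nr=n and n=n and nc=n] mult_add_distrib_mat[where nr=n and n=n and nc=n]
    assoc_mult_mat[of _ n n _ n _ n] mult_smult_distrib[of _ n n _ n] mult_smult_assoc_mat[of _ n n _ n]
  note [simp] = mult_carrier_mat[of _ n n _ n] smult_carrier_mat[of _ n n] add_carrier_mat[of _ n n]
  \<comment> \<open>Entries of products stay unexpanded: after \<open>eq_matI\<close> they act as
    atoms, and only the additive structure is compared entry by entry.\<close>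
  note [simp del] = index_mult_mat(1)
  \<comment> \<open>Products are normalised by nesting to the right, so the cube also occurs with a
    trailing factor.\<close>
  have cube': "K * (K * (K * M)) = \<kappa> \<cdot>\<^sub>m M" if "M \<in> carrier_mat n n" for M
  proof -
    have "K * (K * (K * M)) = K * (K * K) * M" using that by simp
    then show ?thesis unfolding cube using that by simp
  qed
  note [simp] = cube cube'
  have P: "P \<in> carrier_mat n n" by (simp add: P_def)
  note four_block_mult = mult_four_block_mat[where ?nr1.0=n and ?n1.0=n and ?n2.0=n
      and ?nr2.0=n and ?nc1.0=n and ?nc2.0=n]
  define i where "i = inverse \<kappa>"
  have i: "i * \<kappa> = 1" "\<kappa> * i = 1"
    using \<kappa> by (simp_all add: i_def)
  have assoc': "i * (\<kappa> * x) = x" "\<kappa> * (i * x) = x" for x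
    using i by (simp_all add: mult.assoc[symmetric])
  \<comment> \<open>Block elimination in \<open>?X\<close> leaves
    \<open>P - E * (E + K) = K * K\<close>, whose inverse is \<open>i\<close> times
    \<open>K\<close>. Back substitution gives the blocks of \<open>?X'\<close>, with
    \<open>Q\<close> in the lower left.\<close>
  define Q where "Q = 1\<^sub>m n + i \<cdot>\<^sub>m ((E + K) * (K * E))"
  have Q: "Q \<in> carrier_mat n n" by (simp add: Q_def)
  let ?X' = "four_block_mat (- (i \<cdot>\<^sub>m (K * E))) (i \<cdot>\<^sub>m K) Q (- (i \<cdot>\<^sub>m ((E + K) * K)))"
  \<comment> \<open>\<open>?Y\<close> is the conjugate of \<open>?X\<close> by
    \<open>diag(1, -1)\<close>, so only the off-diagonal blocks of the inverse change sign.\<close>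
  let ?Y' = "four_block_mat (- (i \<cdot>\<^sub>m (K * E))) (- (i \<cdot>\<^sub>m K)) (- Q) (- (i \<cdot>\<^sub>m ((E + K) * K)))"
  have block_one: "four_block_mat M\<^sub>1 M\<^sub>2 M\<^sub>3 M\<^sub>4 = 1\<^sub>m (n + n)"
    if "M\<^sub>1 = 1\<^sub>m n" "M\<^sub>2 = 0\<^sub>m n n" "M\<^sub>3 = 0\<^sub>m n n" "M\<^sub>4 = 1\<^sub>m n" for M\<^sub>1 M\<^sub>2 M\<^sub>3 M\<^sub>4 :: "complex mat"
    using that by simp
  have inverses: "?X * ?X' = 1\<^sub>m (n + n)" "?X' * ?X = 1\<^sub>m (n + n)"
    "?Y * ?Y' = 1\<^sub>m (n + n)" "?Y' * ?Y = 1\<^sub>m (n + n)"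
    by (simp_all add: P Q four_block_mult)
      ((rule block_one; (simp add: P_def Q_def)?; intro eq_matI; simp add: algebra_simps i assoc')+)
  have "?X \<in> carrier (GL (n + n))" "?Y \<in> carrier (GL (n + n))"
    by (rule GL_carrierI[OF _ _ inverses(1,2)] GL_carrierI[OF _ _ inverses(3,4)]; simp add: P Q)+
  \<comment> \<open>Both sides are block diagonal with blocks \<open>-\<kappa>\<close> and
    \<open>\<kappa>\<close>. Up to sign, their lower left block is \<open>K^3 E - E K^3\<close>,
    which vanishes because the cube is scalar.\<close>
  moreover have "?X * (?Y * ?X) = ?Y * (?X * ?Y)"
    by (simp add: P four_block_mult, intro cong_four_block_mat)
      (simp_all add: P_def, (intro eq_matI; simp)+)
  ultimately show ?thesis by (rule defines_B3_representationI)
qed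

text \<open>Transports the normal form back along \<open>diag(1, B)\<close>. The assumption
  \<open>KB\<close> expresses \<open>K = A - B * D * Bi\<close> without an inverse, so that it can
  be checked on explicit matrices as polynomial identities.\<close>

lemma block_braid_representation:
  fixes A B Bi D K :: "complex mat"
  assumes A: "A \<in> carrier_mat n n" and B: "B \<in> carrier_mat n n" and Bi: "Bi \<in> carrier_mat n n"
    and D: "D \<in> carrier_mat n n" and K: "K \<in> carrier_mat n n"
    and inverses: "B * Bi = 1\<^sub>m n" "Bi * B = 1\<^sub>m n"
    and KB: "K * B = A * B - B * D"
    and cube: "K * (K * K) = \<kappa> \<cdot>\<^sub>m 1\<^sub>m n" and \<kappa>: "\<kappa> \<noteq> 0"
  defines "C \<equiv> Bi * (A * A) - Bi * A * B * D * Bi + D * D * Bi"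
  shows "defines_B3_representation (n + n) (four_block_mat A B C D) (four_block_mat A (- B) (- C) D)"
proof -
  note [simp] = A B Bi D K carrier_matD[OF A] carrier_matD[OF B] carrier_matD[OF Bi]
    carrier_matD[OF D] carrier_matD[OF K]
    add_mult_distrib_mat[where nr=n and n=n and nc=n] mult_add_distrib_mat[where nr=n and n=n and nc=n]
    minus_mult_distrib_mat[where nr=n and n=n and nc=n] mult_minus_distrib_mat[where nr=n and n=n and nc=n]
    assoc_mult_mat[of _ n n _ n _ n] mult_carrier_mat[of _ n n _ n] add_carrier_mat[of _ n n]
    minus_carrier_mat[of _ n n]
  note [simp del] = index_mult_mat(1)
  have cancel: "B * (Bi * M) = M" "Bi * (B * M) = M" if "M \<in> carrier_mat n n" for M
    using that inverses assoc_mult_mat[OF B Bi that] assoc_mult_mat[OF Bi B that] by simp_all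
  note [simp] = inverses cancel
  define E where "E = B * (D * Bi)"
  define P where "P = K * K + E * K + E * E"
  have E: "E \<in> carrier_mat n n" and P: "P \<in> carrier_mat n n"
    by (simp_all add: E_def P_def)
  have "A * B = E * B + K * B"
    unfolding KB by (simp add: E_def) (intro eq_matI; simp)
  then have "A * B * Bi = (E * B + K * B) * Bi"
    by simp
  then have A_eq: "A = E + K"
    using E by simp
  have C: "C \<in> carrier_mat n n"
    by (simp add: C_def)
  \<comment> \<open>Conjugation turns the lower left block \<open>P\<close> into
    \<open>Bi * P\<close>; the prescribed \<open>C\<close> is exactly this block.\<close>
  have BiP: "Bi * P = C"
    unfolding C_def A_eq P_def using E
    by (simp add: E_def) (intro eq_matI; simp)
  let ?T = "four_block_mat (1\<^sub>m n) (0\<^sub>m n n) (0\<^sub>m n n) B"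
  let ?Ti = "four_block_mat (1\<^sub>m n) (0\<^sub>m n n) (0\<^sub>m n n) Bi"
  note four_block_mult = mult_four_block_mat[where ?nr1.0=n and ?n1.0=n and ?n2.0=n
      and ?nr2.0=n and ?nc1.0=n and ?nc2.0=n]
  have "defines_B3_representation (n + n)
    (?Ti * (four_block_mat A (1\<^sub>m n) P E * ?T)) (?Ti * (four_block_mat A (- 1\<^sub>m n) (- P) E * ?T))"
    by (rule defines_B3_representation_conj)
      (simp_all add: four_block_mult A_eq P_def braid_of_cube_scalar[OF E K cube \<kappa>])
  moreover have "?Ti * (four_block_mat A (1\<^sub>m n) P E * ?T) = four_block_mat A B C D"
    using E P C by (simp add: four_block_mult BiP) (simp add: E_def)
  moreover have "- 0\<^sub>m n n = (0\<^sub>m n n :: complex mat)"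
    by (intro eq_matI) simp_all
  then have "?Ti * (four_block_mat A (- 1\<^sub>m n) (- P) E * ?T) = four_block_mat A (- B) (- C) D"
    using E P C by (simp add: four_block_mult BiP) (simp add: E_def)
  ultimately show ?thesis by simp
qed

text \<open>The left side factors as \<open>B * ((?C - X) * B)\<close>, and the invertible outer
  factors cancel. This gives the uniqueness of \<open>C\<close>.\<close>

lemma block_equation_iff:
  fixes A B Bi D X :: "complex mat"
  assumes A: "A \<in> carrier_mat n n" and B: "B \<in> carrier_mat n n" and Bi: "Bi \<in> carrier_mat n n"
    and D: "D \<in> carrier_mat n n" and X: "X \<in> carrier_mat n n"
    and inverses: "B * Bi = 1\<^sub>m n" "Bi * B = 1\<^sub>m n"
  shows "A * A * B - B * X * B - A * B * D + B * (D * D) = 0\<^sub>m n n \<longleftrightarrow>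
    X = Bi * (A * A) - Bi * A * B * D * Bi + D * D * Bi"
    (is "?lhs = 0\<^sub>m n n \<longleftrightarrow> X = ?C")
proof -
  note [simp] = A B Bi D X carrier_matD[OF A] carrier_matD[OF B] carrier_matD[OF Bi]
    carrier_matD[OF D] carrier_matD[OF X]
    add_mult_distrib_mat[where nr=n and n=n and nc=n] mult_add_distrib_mat[where nr=n and n=n and nc=n]
    minus_mult_distrib_mat[where nr=n and n=n and nc=n] mult_minus_distrib_mat[where nr=n and n=n and nc=n]
    assoc_mult_mat[of _ n n _ n _ n] mult_carrier_mat[of _ n n _ n] add_carrier_mat[of _ n n]
    minus_carrier_mat[of _ n n]
  note [simp del] = index_mult_mat(1)
  have cancel: "B * (Bi * M) = M" "Bi * (B * M) = M" if "M \<in> carrier_mat n n" for M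
    using that inverses assoc_mult_mat[OF B Bi that] assoc_mult_mat[OF Bi B that] by simp_all
  note [simp] = inverses cancel
  have lhs: "?lhs = B * ((?C - X) * B)"
    by simp (intro eq_matI; simp)
  show ?thesis
  proof
    assume "?lhs = 0\<^sub>m n n"
    then have "Bi * (B * ((?C - X) * B)) * Bi = 0\<^sub>m n n"
      unfolding lhs by simp
    moreover have "Bi * (B * ((?C - X) * B)) * Bi = ?C - X"
      by simp
    ultimately have zero: "?C - X = 0\<^sub>m n n" by simp
    have "?C = (?C - X) + X"
      by (intro eq_matI) simp_all
    then show "X = ?C" unfolding zero by simp
  next
    assume "X = ?C"
    then have "?C - X = 0\<^sub>m n n" by simp
    then show "?lhs = 0\<^sub>m n n" unfolding lhs by simp
  qed
qed

section \<open>Explicit 3 by 3 matrices\<close>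

text \<open>As a mere abbreviation it lets the rules below apply directly to matrices written with
  \<open>mat_of_rows_list\<close>.\<close>

abbreviation (input) mat3 :: "'a \<Rightarrow> 'a \<Rightarrow> 'a \<Rightarrow> 'a \<Rightarrow> 'a \<Rightarrow> 'a \<Rightarrow> 'a \<Rightarrow> 'a \<Rightarrow> 'a \<Rightarrow> 'a mat" where
  "mat3 a b c d e f g h i \<equiv> mat_of_rows_list 3 [[a, b, c], [d, e, f], [g, h, i]]"

lemma mat3_carrier [simp]: "mat3 a b c d e f g h i \<in> carrier_mat 3 3"
  by (rule carrier_matI) (simp_all add: mat_of_rows_list_def)

lemma less_3_cases: "i < (3::nat) \<Longrightarrow> i = 0 \<or> i = 1 \<or> i = 2"
  by linarith

lemma mat3_eqI:
  assumes "M \<in> carrier_mat 3 3"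
    "M $$ (0,0) = a" "M $$ (0,1) = b" "M $$ (0,2) = c"
    "M $$ (1,0) = d" "M $$ (1,1) = e" "M $$ (1,2) = f"
    "M $$ (2,0) = g" "M $$ (2,1) = h" "M $$ (2,2) = i"
  shows "M = mat3 a b c d e f g h i"
proof (rule eq_matI)
  fix k l assume "k < dim_row (mat3 a b c d e f g h i)" "l < dim_col (mat3 a b c d e f g h i)"
  then have "k < 3" "l < 3" by (simp_all add: mat_of_rows_list_def)
  then show "M $$ (k, l) = mat3 a b c d e f g h i $$ (k, l)"
    using assms by (auto dest!: less_3_cases simp: mat_of_rows_list_def)
qed (use assms(1) in \<open>simp_all add: mat_of_rows_list_def\<close>)

lemma mat3_mult:
  fixes a :: "'a::comm_ring_1"
  shows "mat3 a b c d e f g h i * mat3 a' b' c' d' e' f' g' h' i' =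
    mat3 (a*a' + b*d' + c*g') (a*b' + b*e' + c*h') (a*c' + b*f' + c*i')
         (d*a' + e*d' + f*g') (d*b' + e*e' + f*h') (d*c' + e*f' + f*i')
         (g*a' + h*d' + i*g') (g*b' + h*e' + i*h') (g*c' + h*f' + i*i')"
  by (rule mat3_eqI, rule mult_carrier_mat[OF mat3_carrier mat3_carrier])
    (simp_all add: mat_of_rows_list_def scalar_prod_def sum.atLeast0_lessThan_Suc eval_nat_numeral)

lemma mat3_minus:
  fixes a :: "'a::comm_ring_1"
  shows "mat3 a b c d e f g h i - mat3 a' b' c' d' e' f' g' h' i' =
    mat3 (a - a') (b - b') (c - c') (d - d') (e - e') (f - f') (g - g') (h - h') (i - i')"
  by (rule mat3_eqI, rule minus_carrier_mat[OF mat3_carrier])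
    (simp_all add: mat_of_rows_list_def)

lemma mat3_scalar:
  fixes k :: "'a::comm_ring_1"
  shows "k \<cdot>\<^sub>m 1\<^sub>m 3 = mat3 k 0 0 0 k 0 0 0 k"
  by (rule mat3_eqI) simp_all

lemma mat3_cong:
  assumes "a = a'" "b = b'" "c = c'" "d = d'" "e = e'" "f = f'" "g = g'" "h = h'" "i = i'"
  shows "mat3 a b c d e f g h i = mat3 a' b' c' d' e' f' g' h' i'"
  using assms by simp

section \<open>The five parameter cases and the explicit matrices\<close>

text \<open>The numbers \<open>2 a\<close>, \<open>p\<close>, \<open>q\<close> are the diagonal entries of \<open>K\<close>.\<close>

lemma cube_scaling_parameters:
  fixes a d f g w :: complex
  assumes "w * w = -3" and "a \<noteq> -1"
    and "(d = 1 + 2*a \<and> (g = -1 + w*a \<or> g = -1 - w*a) \<and> f \<noteq> 0)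
     \<or> (d = 1 + 2*a \<and> g = 3*a - 1 \<and> f = 1 + a)
     \<or> ((d = 1 - a + w*a \<and> g = -1 - w*a \<and> f \<noteq> 0)
        \<or> (d = 1 - a - w*a \<and> g = -1 + w*a \<and> f \<noteq> 0))
     \<or> ((d = 1 - a + w*a \<and> g = -1 + w*a \<and> f = 1 + a)
        \<or> (d = 1 - a - w*a \<and> g = -1 - w*a \<and> f = 1 + a))
     \<or> ((d = 1 - a + w*a \<or> d = 1 - a - w*a) \<and> g = 3*a - 1 \<and> f = 1 + a)"
  obtains p q where "d = 1 + p" "g = a - 1 + q" "f \<noteq> 0"
    "p * (p * p) = 8 * (a * (a * a))" "q * (q * q) = 8 * (a * (a * a))"
    "f = 1 + a \<or> 4 * (a * a) + 2 * (a * q) + q * q = 0 \<and> p * p + p * q + q * q = 0"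
proof
  show "d = 1 + (d - 1)" "g = a - 1 + (g - a + 1)" by simp_all
  show "f \<noteq> 0" using assms(2,3) by (auto simp: add_eq_0_iff)
  have w: "w * (w * x) = -3 * x" for x using assms(1) by (simp add: mult.assoc[symmetric])
  \<comment> \<open>In every case \<open>d - 1\<close> and \<open>g - a + 1\<close> are
    \<open>2 * a\<close> or \<open>-a\<close> plus or minus \<open>w * a\<close>, that is,
    \<open>2 * a\<close> times a cube root of unity.\<close>
  show "(d - 1) * ((d - 1) * (d - 1)) = 8 * (a * (a * a))"
    using assms(3) by (elim disjE conjE; hypsubst; simp add: algebra_simps w assms(1))
  show "(g - a + 1) * ((g - a + 1) * (g - a + 1)) = 8 * (a * (a * a))"
    using assms(3) by (elim disjE conjE; hypsubst; simp add: algebra_simps w assms(1))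
  \<comment> \<open>In the cases that leave \<open>f\<close> free, \<open>q\<close> comes from a
    cube root of unity different from those of \<open>2 * a\<close> and \<open>p\<close>, so the
    quadratic cofactors of the differences of cubes vanish.\<close>
  show "f = 1 + a \<or> 4 * (a * a) + 2 * (a * (g - a + 1)) + (g - a + 1) * (g - a + 1) = 0 \<and>
      (d - 1) * (d - 1) + (d - 1) * (g - a + 1) + (g - a + 1) * (g - a + 1) = 0"
    using assms(3) by (elim disjE conjE; hypsubst; simp add: algebra_simps w assms(1))
qed

theorem proposition5p2:
  fixes a d f g :: complex and A B C D :: "complex mat"
  assumes a: "a \<notin> {-1, 0, 2, 1/2}"
    and cases:
      "(d = 1 + 2*a \<and> (g = -1 + \<i>*a*complex_of_real (sqrt 3) \<or> g = -1 - \<i>*a*complex_of_real (sqrt 3)) \<and> f \<noteq> 0)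
     \<or> (d = 1 + 2*a \<and> g = 3*a - 1 \<and> f = 1 + a)
     \<or> ((d = 1 - a + \<i>*a*complex_of_real (sqrt 3) \<and> g = -1 - \<i>*a*complex_of_real (sqrt 3) \<and> f \<noteq> 0)
        \<or> (d = 1 - a - \<i>*a*complex_of_real (sqrt 3) \<and> g = -1 + \<i>*a*complex_of_real (sqrt 3) \<and> f \<noteq> 0))
     \<or> ((d = 1 - a + \<i>*a*complex_of_real (sqrt 3) \<and> g = -1 + \<i>*a*complex_of_real (sqrt 3) \<and> f = 1 + a)
        \<or> (d = 1 - a - \<i>*a*complex_of_real (sqrt 3) \<and> g = -1 - \<i>*a*complex_of_real (sqrt 3) \<and> f = 1 + a))
     \<or> ((d = 1 - a + \<i>*a*complex_of_real (sqrt 3) \<or> d = 1 - a - \<i>*a*complex_of_real (sqrt 3)) \<and> g = 3*a - 1 \<and> f = 1 + a)"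
    and A: "A = mat_of_rows_list 3
      [[a,        a - 2, a - 2],
       [-2*a + 1, d,     -2*a + 1],
       [f,        f,     g]]"
    and B: "B = mat_of_rows_list 3
      [[a - 2,   -a + 2,   -a + 2],
       [2*a - 1, -2*a + 1, 2*a - 1],
       [-f,      -f,       f]]"
    and D: "D = mat_of_rows_list 3
      [[-a + 3, 3*a - 3, -a - 1],
       [-a + 2, 3*a - 2, -3*a],
       [3,      2*a - 1, -2*a - 1]]"
    and C: "C = inv\<^bsub>GL 3\<^esub> B * A ^\<^sub>m 2
              - inv\<^bsub>GL 3\<^esub> B * A * B * D * inv\<^bsub>GL 3\<^esub> B
              + D ^\<^sub>m 2 * inv\<^bsub>GL 3\<^esub> B"
  shows "B \<in> carrier (GL 3)
    \<and> (\<forall>X \<in> carrier_mat 3 3.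
         A ^\<^sub>m 2 * B - B * X * B - A * B * D + B * D ^\<^sub>m 2 = 0\<^sub>m 3 3 \<longleftrightarrow> X = C)
    \<and> defines_B3_representation 6 (four_block_mat A B C D) (four_block_mat A (- B) (- C) D)"
proof -
  have w: "(\<i> * complex_of_real (sqrt 3)) * (\<i> * complex_of_real (sqrt 3)) = -3"
    by (simp add: algebra_simps flip: of_real_mult)
  from a have "a \<noteq> -1" by simp
  then obtain p q where d: "d = 1 + p" and g: "g = a - 1 + q" and f: "f \<noteq> 0"
    and p: "p * (p * p) = 8 * (a * (a * a))" and q: "q * (q * q) = 8 * (a * (a * a))"
    and pq: "f = 1 + a \<or> 4 * (a * a) + 2 * (a * q) + q * q = 0 \<and> p * p + p * q + q * q = 0"
    using cube_scaling_parameters[OF w, of a d g f] cases by (auto simp: ac_simps)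
  have a0: "a \<noteq> 0" "a - 2 \<noteq> 0" "2 * a - 1 \<noteq> 0"
    using a by (auto simp: field_simps)
  \<comment> \<open>\<open>B\<close> is \<open>diag(a - 2, 2 * a - 1, f)\<close> times a matrix of
    signs. Inverting both factors gives \<open>Bi\<close>; the halves come from the sign
    matrix.\<close>
  define x y z where "x = inverse (a - 2) / 2" "y = inverse (2 * a - 1) / 2" "z = inverse f / 2"
  have xyz: "x * (a - 2) = 1/2" "x * (2 - a) = - 1/2" "y * (2 * a - 1) = 1/2"
    "y * (1 - 2 * a) = - 1/2" "z * f = 1/2"
    using a0 f by (simp_all add: x_y_z_def divide_simps)
  define Bi where "Bi = mat3 0 y (- z) (- x) 0 (- z) (- x) y 0"
  \<comment> \<open>These are the third-column entries of \<open>A - B * D * Bi\<close> above the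
    diagonal; they vanish when \<open>f = 1 + a\<close>.\<close>
  define u v where "u = (a - 2) * (f - 1 - a) / f" "v = - (2 * a - 1) * (f - 1 - a) / f"
  have uv: "u * f = (a - 2) * (f - 1 - a)" "f * u = (a - 2) * (f - 1 - a)"
    "v * f = - (2 * a - 1) * (f - 1 - a)" "f * v = - (2 * a - 1) * (f - 1 - a)"
    using f by (simp_all add: u_v_def)
  \<comment> \<open>These are the off-diagonal entries that remain in \<open>K * (K * K)\<close>.
    Either \<open>u\<close> and \<open>v\<close> vanish or the quadratic factors do.\<close>
  have uv_zero: "u * (4 * (a * a) + 2 * (a * q) + q * q) = 0" "v * (p * p + p * q + q * q) = 0"
    using pq by (auto simp: u_v_def)
  define K where "K = mat3 (2 * a) 0 u 0 p v 0 0 q"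
  have carrier [simp]: "A \<in> carrier_mat 3 3" "B \<in> carrier_mat 3 3" "Bi \<in> carrier_mat 3 3"
    "D \<in> carrier_mat 3 3" "K \<in> carrier_mat 3 3"
    by (simp_all add: A B Bi_def D K_def)
  have one: "(1\<^sub>m 3 :: complex mat) = mat3 1 0 0 0 1 0 0 0 1"
    by (rule mat3_eqI) simp_all
  have BiB: "Bi * B = 1\<^sub>m 3"
    unfolding B Bi_def mat3_mult one by (intro mat3_cong; simp add: xyz)
  have BBi: "B * Bi = 1\<^sub>m 3"
    by (rule mat_mult_left_right_inverse[OF _ _ BiB]) simp_all
  have KB: "K * B = A * B - B * D"
    unfolding A B D K_def mat3_mult mat3_minus
    unfolding d g by (intro mat3_cong; simp add: algebra_simps uv)
  have "K * (K * K) = mat3 (8 * (a * (a * a))) 0 (u * (4 * (a * a) + 2 * (a * q) + q * q))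
      0 (p * (p * p)) (v * (p * p + p * q + q * q)) 0 0 (q * (q * q))"
    unfolding K_def mat3_mult by (intro mat3_cong; simp add: algebra_simps)
  then have cube: "K * (K * K) = (8 * (a * (a * a))) \<cdot>\<^sub>m 1\<^sub>m 3"
    unfolding p q uv_zero mat3_scalar .
  have inv_B: "inv\<^bsub>GL 3\<^esub> B = Bi"
    by (rule GL_inv_eq) (simp_all add: BBi BiB)
  have sq: "A ^\<^sub>m 2 = A * A" "D ^\<^sub>m 2 = D * D"
    by (simp_all add: numeral_2_eq_2)
  have C': "C = Bi * (A * A) - Bi * A * B * D * Bi + D * D * Bi"
    unfolding C inv_B sq ..
  have "B \<in> carrier (GL 3)"
    by (rule GL_carrierI[OF _ _ BBi BiB]) simp_all
  moreover have "\<forall>X \<in> carrier_mat 3 3.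
      A ^\<^sub>m 2 * B - B * X * B - A * B * D + B * D ^\<^sub>m 2 = 0\<^sub>m 3 3 \<longleftrightarrow> X = C"
    unfolding sq C' by (intro ballI block_equation_iff BBi BiB) simp_all
  \<comment> \<open>The scalar \<open>8 * (a * (a * a))\<close> is nonzero since
    \<open>a \<noteq> 0\<close>, and the block size \<open>3 + 3\<close> evaluates to
    \<open>6\<close>.\<close>
  moreover have "defines_B3_representation 6 (four_block_mat A B C D) (four_block_mat A (- B) (- C) D)"
    using block_braid_representation[OF _ _ _ _ _ BBi BiB KB cube] a0 unfolding C' by simp
  ultimately show ?thesis by blast
qed

end
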